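(* Let $s,t,a,b$ be integers with $2\le a\le s$, $2\le b\le t$ and $ab\ge s+t$. Then $$r\!\left(K_{n,n},K_{s,t},st-ab+2\right)=\Omega\!\left(n^{1/\min\{a,b\}}\right).$$
   Context: For graphs $G,H$ and an integer $q$ with $2\le q\le |E(H)|$, an $(H,q)$-coloring of $G$ is an edge-coloring of $G$ in which every subgraph of $G$ isomorphic to $H$ receives at least $q$ distinct colors; $r(G,H,q)$ is the minimum number of colors needed for $G$ to have an $(H,q)$-coloring. $K_{n,n}$, $K_{s,t}$ denote complete bipartite graphs. Asymptotic notation refers to $n\to\infty$ with $s,t,a,b$ fixed. *)

theory Defs
  imports Complex_Main "HOL-Library.Landau_Symbols"
begin

record 'v ugraph =
  verts :: "'v set"
  edges :: "'v set set"

text \<open>Finite simple graphs: an edge is an unordered pair of distinct vertices.\<close>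

definition simple_graph :: "'v ugraph \<Rightarrow> bool" where
  "simple_graph G \<longleftrightarrow> finite (verts G) \<and>
     edges G \<subseteq> {{u, v} | u v. u \<in> verts G \<and> v \<in> verts G \<and> u \<noteq> v}"

definition subgraph :: "'v ugraph \<Rightarrow> 'v ugraph \<Rightarrow> bool" where
  "subgraph F G \<longleftrightarrow> simple_graph F \<and> verts F \<subseteq> verts G \<and> edges F \<subseteq> edges G"

definition graph_iso :: "'v ugraph \<Rightarrow> 'w ugraph \<Rightarrow> bool" where
  "graph_iso F H \<longleftrightarrow>
     (\<exists>f. bij_betw f (verts F) (verts H) \<and> (\<lambda>e. f ` e) ` edges F = edges H)"

definition complete_bipartite :: "nat \<Rightarrow> nat \<Rightarrow> (nat + nat) ugraph" where
  "complete_bipartite m n =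
     \<lparr>verts = Inl ` {..<m} \<union> Inr ` {..<n},
      edges = {{Inl i, Inr j} | i j. i < m \<and> j < n}\<rparr>"

text \<open>Only the values of \<open>c\<close> on the edges of \<open>G\<close> matter. Subgraphs are not required to be
  induced.\<close>

definition is_coloring ::
    "'v ugraph \<Rightarrow> 'w ugraph \<Rightarrow> nat \<Rightarrow> ('v set \<Rightarrow> nat) \<Rightarrow> bool" where
  "is_coloring G H q c \<longleftrightarrow>
     (\<forall>F. subgraph F G \<and> graph_iso F H \<longrightarrow> q \<le> card (c ` edges F))"

text \<open>For finite \<open>G\<close> and \<open>q \<le> card (edges H)\<close> the set of admissible \<open>k\<close> is nonempty, since an
  injective coloring of the edges of \<open>G\<close> qualifies; so \<open>LEAST\<close> is a genuine minimum in the range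
  \<open>2 \<le> q \<le> card (edges H)\<close> for which the notion is intended.\<close>

definition gen_ramsey :: "'v ugraph \<Rightarrow> 'w ugraph \<Rightarrow> nat \<Rightarrow> nat" where
  "gen_ramsey G H q = (LEAST k. \<exists>c. c ` edges G \<subseteq> {..<k} \<and> is_coloring G H q c)"

end

theory Submission
  imports Defs
begin

text \<open>With \<open>k\<close> colors some color class of \<open>K\<^bsub>n,n\<^esub>\<close> has at least \<open>n\<^sup>2 / k\<close> edges.  By the
  Kovari-Sos-Turan double count (of vertices against distinct \<open>m\<close>-tuples of common neighbors,
  \<open>m = min a b\<close>) that class contains \<open>K\<^bsub>a,b\<^esub>\<close> as soon as \<open>n > C k\<^sup>m\<close>.  A monochromatic
  \<open>K\<^bsub>a,b\<^esub>\<close> extends to a copy of \<open>K\<^bsub>s,t\<^esub>\<close> with at most \<open>1 + (st - ab)\<close> colors.\<close>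

section \<open>The Kovari-Sos-Turan bound\<close>

text \<open>Jensen's inequality for the m-th power, with a lower bound \<open>p\<close> for the mean
  in place of the mean itself. Summing the tangent lines at \<open>p\<close> gives the claim,
  because the linear terms add up to a nonnegative quantity. It turns a bound on the total degree
  into one on the sum of m-th powers of degrees.\<close>

lemma power_mean_sum_ge:
  fixes y :: "'a \<Rightarrow> real"
  assumes "\<And>i. i \<in> A \<Longrightarrow> 0 \<le> y i" and "0 < p" and mean: "real (card A) * p \<le> sum y A"
  shows "real (card A) * p ^ m \<le> (\<Sum>i\<in>A. y i ^ m)"
proof -
  \<comment> \<open>Bernoulli's inequality is the tangent line of the power function at \<open>p\<close>.\<close>
  have tangent: "p ^ m * (1 + real m * (y i / p - 1)) \<le> y i ^ m" if "i \<in> A" for i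
  proof -
    have "y i / p \<ge> 0"
      using assms(1)[OF that] \<open>0 < p\<close> by simp
    then have "1 + real m * (y i / p - 1) \<le> (1 + (y i / p - 1)) ^ m"
      by (intro Bernoulli_inequality) auto
    then have "p ^ m * (1 + real m * (y i / p - 1)) \<le> p ^ m * (y i / p) ^ m"
      using \<open>0 < p\<close> by (intro mult_left_mono) auto
    also have "\<dots> = y i ^ m"
      using \<open>0 < p\<close> by (simp flip: power_mult_distrib)
    finally show ?thesis .
  qed
  have "0 \<le> sum y A / p - real (card A)"
    using mean \<open>0 < p\<close> by (simp add: field_simps)
  then have "p ^ m * real (card A) \<le> p ^ m * (real (card A) + real m * (sum y A / p - real (card A)))"
    using \<open>0 < p\<close> by (intro mult_left_mono) auto
  also have "\<dots> = (\<Sum>i\<in>A. p ^ m * (1 + real m * (y i / p - 1)))"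
    by (simp add: sum.distrib sum_subtractf sum_divide_distrib flip: sum_distrib_left)
  also have "\<dots> \<le> (\<Sum>i\<in>A. y i ^ m)"
    by (intro sum_mono tangent)
  finally show ?thesis
    by (simp add: mult.commute)
qed

text \<open>The count is a falling factorial whose \<open>m\<close> factors all exceed
  \<open>card A - m\<close>. For \<open>card A < m\<close> the truncated difference is 0, and so is
  its power since \<open>0 < m\<close>.\<close>

lemma card_distinct_lists_ge:
  assumes "finite A" and "0 < m"
  shows "(card A - m) ^ m \<le> card {xs. length xs = m \<and> distinct xs \<and> set xs \<subseteq> A}"
proof (cases "m \<le> card A")
  case True
  have "(card A - m) ^ m = (\<Prod>i\<in>{card A - m + 1 .. card A}. card A - m)"
    using True by simp
  also have "\<dots> \<le> \<Prod>{card A - m + 1 .. card A}"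
    by (intro prod_mono) auto
  finally show ?thesis
    by (simp add: card_lists_distinct_length_eq[OF \<open>finite A\<close> True])
qed (use \<open>0 < m\<close> in \<open>simp add: power_0_left\<close>)

text \<open>Count the pairs of some \<open>u\<close> in \<open>A\<close> and a list of
  \<open>m\<close> distinct elements of \<open>B\<close>, all related to \<open>u\<close>. Each
  \<open>u\<close> contributes at least the summand on the left, while more than \<open>M\<close>
  common neighbors of one list would give a forbidden biclique. Lists instead of sets avoid binomial
  coefficients.\<close>

lemma biclique_free_degree_bound:
  assumes "finite A" and "finite B" and "0 < m"
    and free: "\<And>S T. S \<subseteq> A \<Longrightarrow> T \<subseteq> B \<Longrightarrow> card S = M \<Longrightarrow> card T = m \<Longrightarrow> \<exists>u\<in>S. \<exists>v\<in>T. \<not> R u v"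
  shows "(\<Sum>u\<in>A. (card {v\<in>B. R u v} - m) ^ m) \<le> M * card B ^ m"
proof -
  let ?L = "{xs. length xs = m \<and> distinct xs \<and> set xs \<subseteq> B}"
  let ?all = "{xs. set xs \<subseteq> B \<and> length xs = m}"
  have fin: "finite ?all"
    using \<open>finite B\<close> by (rule finite_lists_length_eq)
  then have finL: "finite ?L"
    by (rule rev_finite_subset) auto
  have codegree: "card {u\<in>A. \<forall>v\<in>set xs. R u v} \<le> M" if "xs \<in> ?L" for xs
  proof (rule ccontr)
    assume "\<not> ?thesis"
    then obtain S where S: "S \<subseteq> {u\<in>A. \<forall>v\<in>set xs. R u v}" "card S = M"
      by (meson nat_le_linear obtain_subset_with_card_n)
    have "card (set xs) = m"
      using that by (auto simp: distinct_card)
    then show False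
      using free[of S "set xs"] S that by blast
  qed
  have "(\<Sum>u\<in>A. (card {v\<in>B. R u v} - m) ^ m) \<le> (\<Sum>u\<in>A. card {xs\<in>?L. \<forall>v\<in>set xs. R u v})"
  proof (rule sum_mono)
    fix u
    have "(card {v\<in>B. R u v} - m) ^ m
        \<le> card {xs. length xs = m \<and> distinct xs \<and> set xs \<subseteq> {v\<in>B. R u v}}"
      using \<open>finite B\<close> \<open>0 < m\<close> by (intro card_distinct_lists_ge) auto
    also have "{xs. length xs = m \<and> distinct xs \<and> set xs \<subseteq> {v\<in>B. R u v}}
        = {xs\<in>?L. \<forall>v\<in>set xs. R u v}"
      by auto
    finally show "(card {v\<in>B. R u v} - m) ^ m \<le> card {xs\<in>?L. \<forall>v\<in>set xs. R u v}" .
  qed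
  also have "\<dots> = (\<Sum>xs\<in>?L. card {u\<in>A. \<forall>v\<in>set xs. R u v})"
    using \<open>finite A\<close> finL by (intro sum_multicount_gen) auto
  also have "\<dots> \<le> card ?L * M"
    using sum_bounded_above[of ?L "\<lambda>xs. card {u\<in>A. \<forall>v\<in>set xs. R u v}" M] codegree by simp
  also have "\<dots> \<le> card ?all * M"
    by (intro mult_right_mono card_mono fin) auto
  finally show ?thesis
    using \<open>finite B\<close> by (simp add: card_lists_length_eq mult.commute)
qed

text \<open>Without a biclique, the degree bound gives an upper estimate of order
  \<open>n ^ m\<close> for the power sum, while the density and convexity give a lower one of order
  \<open>n ^ (m + 1)\<close>; \<open>large2\<close> makes them incompatible.\<close>

lemma biclique_exists:
  assumes "0 < m" and "0 < k" and dense: "n\<^sup>2 \<le> k * (\<Sum>u<n. card {v\<in>{..<n}. R u v})"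
    and large1: "2 * m * k < n" and large2: "M * (2 * k) ^ m < n"
  shows "\<exists>S T. S \<subseteq> {..<n} \<and> T \<subseteq> {..<n} \<and> card S = M \<and> card T = m \<and> (\<forall>u\<in>S. \<forall>v\<in>T. R u v)"
proof (rule ccontr)
  assume "\<not> ?thesis"
  then have bound: "(\<Sum>u<n. (card {v\<in>{..<n}. R u v} - m) ^ m) \<le> M * n ^ m"
    using biclique_free_degree_bound[of "{..<n}" "{..<n}" m M R] \<open>0 < m\<close> by force
  define d where "d u = card {v\<in>{..<n}. R u v}" for u
  \<comment> \<open>Half of the lower bound \<open>n / k\<close> for the average degree. The other
    half pays for the loss of \<open>m\<close> in each \<open>d u - m\<close>, because
    \<open>large1\<close> gives \<open>m \<le> p\<close>.\<close>
  define p where "p = real n / (2 * real k)"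
  have "0 < n"
    using large1 by simp
  have "0 < p"
    using \<open>0 < n\<close> \<open>0 < k\<close> by (simp add: p_def)
  have "real m \<le> p"
  proof -
    have "real (2 * m * k) \<le> real n"
      using large1 by linarith
    then show ?thesis
      using \<open>0 < k\<close> by (simp add: p_def field_simps)
  qed
  have "real n * (2 * p) \<le> (\<Sum>u<n. real (d u))"
  proof -
    have "real (n\<^sup>2) \<le> real (k * (\<Sum>u<n. d u))"
      using dense unfolding d_def of_nat_le_iff .
    then show ?thesis
      using \<open>0 < k\<close> by (simp add: p_def field_simps power2_eq_square)
  qed
  \<comment> \<open>Truncation at 0 in the natural difference can only increase the sum.\<close>
  moreover have "(\<Sum>u<n. real (d u)) - real n * real m \<le> (\<Sum>u<n. real (d u - m))"
  proof -
    have "(\<Sum>u<n. real (d u) - real m) \<le> (\<Sum>u<n. real (d u - m))"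
      by (intro sum_mono) auto
    then show ?thesis
      by (simp add: sum_subtractf)
  qed
  moreover have "real n * real m \<le> real n * p"
    using \<open>real m \<le> p\<close> by (simp add: mult_left_mono)
  ultimately have "real (card {..<n}) * p \<le> (\<Sum>u<n. real (d u - m))"
    by simp
  then have "real n * p ^ m \<le> (\<Sum>u<n. real (d u - m) ^ m)"
    using power_mean_sum_ge[of "{..<n}" "\<lambda>u. real (d u - m)" p m] \<open>0 < p\<close> by simp
  also have "\<dots> = real (\<Sum>u<n. (d u - m) ^ m)"
    by simp
  also have "\<dots> \<le> real (M * n ^ m)"
    using bound unfolding d_def of_nat_le_iff .
  finally have "real n * p ^ m \<le> real M * real n ^ m"
    by simp
  \<comment> \<open>Writing \<open>n ^ m\<close> as \<open>(2 * k) ^ m * p ^ m\<close> lets the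
    factor \<open>p ^ m\<close> cancel.\<close>
  moreover have "p * (2 * real k) = real n"
    using \<open>0 < k\<close> by (simp add: p_def)
  ultimately have "real n * p ^ m \<le> (real M * (2 * real k) ^ m) * p ^ m"
    by (metis mult.assoc mult.commute power_mult_distrib)
  then have "real n \<le> real M * (2 * real k) ^ m"
    using \<open>0 < p\<close> by simp
  also have "\<dots> = real (M * (2 * k) ^ m)"
    by simp
  finally show False
    using large2 by linarith
qed

text \<open>Pigeonhole: the \<open>k\<close> color classes partition the \<open>n\<^sup>2\<close>
  pairs, so one of them has at least the average size and is dense enough for a biclique.\<close>

lemma monochromatic_biclique:
  fixes \<chi> :: "nat \<Rightarrow> nat \<Rightarrow> nat"
  assumes col: "\<And>u v. u < n \<Longrightarrow> v < n \<Longrightarrow> \<chi> u v < k"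
    and "0 < m" and "0 < k" and large1: "2 * m * k < n" and large2: "M * (2 * k) ^ m < n"
  shows "\<exists>i S T. S \<subseteq> {..<n} \<and> T \<subseteq> {..<n} \<and> card S = M \<and> card T = m \<and>
    (\<forall>u\<in>S. \<forall>v\<in>T. \<chi> u v = i)"
proof -
  define e where "e i = (\<Sum>u<n. card {v\<in>{..<n}. \<chi> u v = i})" for i
  have row: "(\<Sum>i<k. card {v\<in>{..<n}. \<chi> u v = i}) = n" if "u < n" for u
  proof -
    have "(\<Sum>i<k. card {v\<in>{..<n}. \<chi> u v = i}) = card (\<Union>i\<in>{..<k}. {v\<in>{..<n}. \<chi> u v = i})"
      by (intro card_UN_disjoint[symmetric]) auto
    also have "(\<Union>i\<in>{..<k}. {v\<in>{..<n}. \<chi> u v = i}) = {..<n}"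
      using col that by auto
    finally show ?thesis
      by simp
  qed
  have "(\<Sum>i<k. e i) = (\<Sum>u<n. \<Sum>i<k. card {v\<in>{..<n}. \<chi> u v = i})"
    unfolding e_def by (rule sum.swap)
  also have "\<dots> = n\<^sup>2"
    using sum.cong[OF refl row, of "{..<n}"] by (simp only: lessThan_iff sum_constant card_lessThan of_nat_id power2_eq_square)
  finally have total: "(\<Sum>i<k. e i) = n\<^sup>2" .
  have "\<exists>i<k. n\<^sup>2 \<le> k * e i"
  proof (rule ccontr)
    assume "\<not> ?thesis"
    then have "(\<Sum>i<k. k * e i) < (\<Sum>i<k. n\<^sup>2)"
      using \<open>0 < k\<close> by (intro sum_strict_mono) (auto simp: not_le)
    then show False
      by (simp only: total sum_distrib_left[symmetric] sum_constant card_lessThan of_nat_id)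
  qed
  then obtain i where "n\<^sup>2 \<le> k * (\<Sum>u<n. card {v\<in>{..<n}. \<chi> u v = i})"
    unfolding e_def by blast
  from biclique_exists[OF \<open>0 < m\<close> \<open>0 < k\<close> this large1 large2] show ?thesis
    by (rule exI)
qed

section \<open>Copies of complete bipartite graphs\<close>

text \<open>Arbitrary parts allow copies inside \<open>complete_bipartite n n\<close> to keep their
  vertex labels. With the edges as an image of \<open>S \<times> T\<close>, counting edges and
  colors reduces to products.\<close>

definition biclique :: "nat set \<Rightarrow> nat set \<Rightarrow> (nat + nat) ugraph" where
  "biclique S T = \<lparr>verts = Inl ` S \<union> Inr ` T, edges = (\<lambda>(i, j). {Inl i, Inr j}) ` (S \<times> T)\<rparr>"

lemma complete_bipartite_eq_biclique: "complete_bipartite m n = biclique {..<m} {..<n}"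
  by (auto simp: complete_bipartite_def biclique_def)

lemma inj_on_biclique_edge: "inj_on (\<lambda>(i, j). {Inl i, Inr j}) X"
  by (auto simp: inj_on_def doubleton_eq_iff)

lemma card_edges_biclique: "card (edges (biclique S T)) = card S * card T"
  by (simp add: biclique_def card_image[OF inj_on_biclique_edge] card_cartesian_product)

lemma subgraph_biclique:
  assumes "finite S" and "finite T" and "S \<subseteq> S'" and "T \<subseteq> T'"
  shows "subgraph (biclique S T) (biclique S' T')"
  using assms unfolding subgraph_def simple_graph_def biclique_def by auto

text \<open>Number the two parts separately and glue the numberings with \<open>map_sum\<close>; on
  edges this acts as the product map on \<open>S \<times> T\<close>.\<close>

lemma graph_iso_biclique:
  assumes "finite S" and "finite T"
  shows "graph_iso (biclique S T) (complete_bipartite (card S) (card T))"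
proof -
  obtain f g where f: "bij_betw f S {..<card S}" and g: "bij_betw g T {..<card T}"
    using ex_bij_betw_finite_nat[OF \<open>finite S\<close>] ex_bij_betw_finite_nat[OF \<open>finite T\<close>]
    by (auto simp: atLeast0LessThan)
  have f_im: "f ` S = {..<card S}" and g_im: "g ` T = {..<card T}"
    using f g by (auto simp: bij_betw_def)
  have "inj_on (map_sum f g) (Inl ` S \<union> Inr ` T)"
    using bij_betw_imp_inj_on[OF f] bij_betw_imp_inj_on[OF g] by (fastforce simp: inj_on_def)
  moreover have "map_sum f g ` (Inl ` S \<union> Inr ` T) = Inl ` (f ` S) \<union> Inr ` (g ` T)"
    by (simp add: image_Un image_image)
  ultimately have verts: "bij_betw (map_sum f g) (Inl ` S \<union> Inr ` T)
      (Inl ` {..<card S} \<union> Inr ` {..<card T})"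
    unfolding f_im g_im by (rule bij_betw_imageI)
  have "(\<lambda>e. map_sum f g ` e) ` edges (biclique S T)
      = (\<lambda>(i, j). {Inl i, Inr j}) ` ((\<lambda>(i, j). (f i, g j)) ` (S \<times> T))"
    by (simp add: biclique_def image_image case_prod_unfold)
  also have "(\<lambda>(i, j). (f i, g j)) ` (S \<times> T) = (f ` S) \<times> (g ` T)"
    by auto
  finally have "(\<lambda>e. map_sum f g ` e) ` edges (biclique S T)
      = edges (biclique {..<card S} {..<card T})"
    by (simp add: biclique_def f_im g_im)
  with verts show ?thesis
    unfolding graph_iso_def complete_bipartite_eq_biclique by (auto simp: biclique_def)
qed

lemma finite_edges_complete_bipartite: "finite (edges (complete_bipartite m n))"
  by (simp add: complete_bipartite_eq_biclique biclique_def)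

text \<open>Ensures that the \<open>LEAST\<close> in \<open>gen_ramsey\<close> is attained. An
  injective coloring works: an isomorphism maps the edges of a copy onto \<open>s * t\<close> edges,
  so the copy has at least that many edges, all colored differently.\<close>

lemma ex_coloring_complete_bipartite:
  assumes "q \<le> s * t"
  shows "\<exists>k c. c ` edges (complete_bipartite n n) \<subseteq> {..<k} \<and>
    is_coloring (complete_bipartite n n) (complete_bipartite s t) q c"
proof -
  let ?G = "complete_bipartite n n"
  obtain c :: "(nat + nat) set \<Rightarrow> nat" where c: "bij_betw c (edges ?G) {0..<card (edges ?G)}"
    using ex_bij_betw_finite_nat[OF finite_edges_complete_bipartite] by blast
  have "q \<le> card (c ` edges F)"
    if F: "subgraph F ?G" "graph_iso F (complete_bipartite s t)" for F :: "(nat + nat) ugraph"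
  proof -
    have sub: "edges F \<subseteq> edges ?G"
      using F(1) by (simp add: subgraph_def)
    obtain f where "(\<lambda>e. f ` e) ` edges F = edges (complete_bipartite s t)"
      using F(2) by (auto simp: graph_iso_def)
    then have "card (edges (complete_bipartite s t)) \<le> card (edges F)"
      by (metis card_image_le finite_edges_complete_bipartite finite_subset sub)
    then have "s * t \<le> card (edges F)"
      by (simp add: complete_bipartite_eq_biclique card_edges_biclique)
    moreover have "card (c ` edges F) = card (edges F)"
      using c sub by (meson bij_betw_def card_image inj_on_subset)
    ultimately show ?thesis
      using assms by simp
  qed
  moreover have "c ` edges ?G \<subseteq> {..<card (edges ?G)}"
    using c by (auto simp: bij_betw_def)
  ultimately show ?thesis
    unfolding is_coloring_def by blast
qed

section \<open>Monochromatic bicliques and the number of colors\<close>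

lemma coloring_no_monochromatic_biclique:
  assumes coloring: "is_coloring (complete_bipartite n n) (complete_bipartite s t) (s * t - a * b + 2) c"
    and "a \<le> s" and "b \<le> t" and "s \<le> n" and "t \<le> n"
    and S: "S \<subseteq> {..<n}" "card S = a" and T: "T \<subseteq> {..<n}" "card T = b"
    and mono: "\<And>u v. u \<in> S \<Longrightarrow> v \<in> T \<Longrightarrow> c {Inl u, Inr v} = i"
  shows False
proof -
  obtain S' where S': "S \<subseteq> S'" "S' \<subseteq> {..<n}" "card S' = s"
    using exists_subset_between[of S s "{..<n}"] assms by auto
  obtain T' where T': "T \<subseteq> T'" "T' \<subseteq> {..<n}" "card T' = t"
    using exists_subset_between[of T t "{..<n}"] assms by auto
  have fin: "finite S'" "finite T'"
    using S'(2) T'(2) finite_subset by blast+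
  let ?c = "\<lambda>(u, v). c {Inl u, Inr v}"
  have "subgraph (biclique S' T') (complete_bipartite n n)"
    unfolding complete_bipartite_eq_biclique using fin S' T' by (intro subgraph_biclique)
  moreover have "graph_iso (biclique S' T') (complete_bipartite s t)"
    using graph_iso_biclique[OF fin] S' T' by simp
  ultimately have "s * t - a * b + 2 \<le> card (c ` edges (biclique S' T'))"
    using coloring by (simp add: is_coloring_def)
  also have "c ` edges (biclique S' T') = ?c ` (S' \<times> T')"
    by (simp add: biclique_def image_image case_prod_unfold)
  \<comment> \<open>All edges inside \<open>S \<times> T\<close> share the color \<open>i\<close>,
    and each remaining edge adds at most one color. The total is at most
    \<open>s * t - a * b + 1\<close>, one short of the requirement.\<close>
  also have "card \<dots> \<le> card (insert i (?c ` (S' \<times> T' - S \<times> T)))"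
    using mono fin by (intro card_mono) auto
  also have "\<dots> \<le> Suc (card (?c ` (S' \<times> T' - S \<times> T)))"
    using fin by (simp add: card_insert_if)
  also have "\<dots> \<le> Suc (card (S' \<times> T' - S \<times> T))"
    using fin by (simp add: card_image_le)
  also have "card (S' \<times> T' - S \<times> T) = s * t - a * b"
  proof -
    have "finite (S \<times> T)"
      using S(1) T(1) finite_subset by blast
    then show ?thesis
      using S S' T T' by (simp add: card_Diff_subset card_cartesian_product Sigma_mono)
  qed
  finally show False
    by simp
qed

text \<open>A larger \<open>n\<close> would meet both size conditions for a monochromatic biclique
  with parts \<open>max a b\<close> and \<open>min a b\<close>. The constant is a crude common bound
  for the coefficients \<open>2 * m\<close> and \<open>M * 2 ^ m\<close> there;
  \<open>k \<le> k ^ m\<close> handles the linear condition.\<close>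

lemma coloring_size_bound:
  assumes "0 < a" and "a \<le> s" and "0 < b" and "b \<le> t" and "s \<le> n" and "t \<le> n" and "0 < k"
    and coloring: "is_coloring (complete_bipartite n n) (complete_bipartite s t) (s * t - a * b + 2) c"
    and colors: "c ` edges (complete_bipartite n n) \<subseteq> {..<k}"
  shows "n \<le> (2 * (a + b)) ^ (a + b) * k ^ min a b"
proof (rule ccontr)
  define m where "m = min a b"
  define M where "M = max a b"
  assume "\<not> ?thesis"
  then have large: "(2 * (a + b)) ^ (a + b) * k ^ m < n"
    by (simp add: m_def)
  have "0 < m" "M \<le> a + b" "m + 1 \<le> a + b"
    using \<open>0 < a\<close> \<open>0 < b\<close> by (auto simp: m_def M_def)
  have col: "c {Inl u, Inr v} < k" if "u < n" "v < n" for u v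
    using colors that by (auto simp: complete_bipartite_def)
  have "2 * m * k \<le> (2 * (a + b)) ^ (a + b) * k ^ m"
  proof (intro mult_mono)
    have "2 * m \<le> 2 * (a + b)"
      by (simp add: m_def)
    also have "\<dots> \<le> (2 * (a + b)) ^ (a + b)"
      using \<open>0 < a\<close> by (intro self_le_power) auto
    finally show "2 * m \<le> (2 * (a + b)) ^ (a + b)" .
    show "k \<le> k ^ m"
      using \<open>0 < k\<close> \<open>0 < m\<close> by (intro self_le_power) auto
  qed auto
  with large have large1: "2 * m * k < n"
    by simp
  have "M * (2 * k) ^ m = (M * 2 ^ m) * k ^ m"
    by (simp add: power_mult_distrib)
  also have "\<dots> \<le> (2 * (a + b)) ^ (a + b) * k ^ m"
  proof (intro mult_right_mono)
    have "M * 2 ^ m \<le> (2 * (a + b)) * (2 * (a + b)) ^ m"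
      using \<open>M \<le> a + b\<close> \<open>0 < a\<close> by (intro mult_mono power_mono) auto
    also have "\<dots> = (2 * (a + b)) ^ (m + 1)"
      by simp
    also have "\<dots> \<le> (2 * (a + b)) ^ (a + b)"
      using \<open>m + 1 \<le> a + b\<close> \<open>0 < a\<close> by (intro power_increasing) auto
    finally show "M * 2 ^ m \<le> (2 * (a + b)) ^ (a + b)" .
  qed auto
  also note large
  finally have large2: "M * (2 * k) ^ m < n" .
  show False
  proof (cases "a \<le> b")
    case True
    then have "m = a" "M = b"
      by (auto simp: m_def M_def)
    \<comment> \<open>The biclique has its smaller part in the second argument of
      \<open>\<chi>\<close>. Here that part must lie on the \<open>Inl\<close> side, so the
      arguments are swapped.\<close>
    obtain S T i where "S \<subseteq> {..<n}" "T \<subseteq> {..<n}" "card S = b" "card T = a"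
      and "\<And>u v. u \<in> S \<Longrightarrow> v \<in> T \<Longrightarrow> c {Inl v, Inr u} = i"
      using monochromatic_biclique[where \<chi> = "\<lambda>u v. c {Inl v, Inr u}",
            OF col \<open>0 < m\<close> \<open>0 < k\<close> large1 large2] \<open>m = a\<close> \<open>M = b\<close> by blast
    with assms show False
      by (intro coloring_no_monochromatic_biclique[OF coloring, of T S i])
  next
    case False
    then have "m = b" "M = a"
      by (auto simp: m_def M_def)
    obtain S T i where "S \<subseteq> {..<n}" "T \<subseteq> {..<n}" "card S = a" "card T = b"
      and "\<And>u v. u \<in> S \<Longrightarrow> v \<in> T \<Longrightarrow> c {Inl u, Inr v} = i"
      using monochromatic_biclique[where \<chi> = "\<lambda>u v. c {Inl u, Inr v}",
            OF col \<open>0 < m\<close> \<open>0 < k\<close> large1 large2] \<open>m = b\<close> \<open>M = a\<close> by blast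
    with assms show False
      by (intro coloring_no_monochromatic_biclique[OF coloring, of S T i])
  qed
qed

theorem theorem1p12:
  fixes s t a b :: nat
  assumes "2 \<le> a" and "a \<le> s" and "2 \<le> b" and "b \<le> t" and "a * b \<ge> s + t"
  shows "(\<lambda>n. real (gen_ramsey (complete_bipartite n n) (complete_bipartite s t) (s * t - a * b + 2)))
           \<in> \<Omega>[at_top](\<lambda>n::nat. real n powr (1 / real (min a b)))"
proof -
  define q where "q = s * t - a * b + 2"
  define m where "m = min a b"
  define C where "C = real ((2 * (a + b)) ^ (a + b))"
  let ?r = "\<lambda>n. gen_ramsey (complete_bipartite n n) (complete_bipartite s t) q"
  have "0 < m"
    using assms by (simp add: m_def)
  have "0 < C"
    using assms by (simp add: C_def)
  \<comment> \<open>Since \<open>2 \<le> a * b \<le> s * t\<close>, the subtraction in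
    \<open>q\<close> is not truncated and \<open>q\<close> does not exceed the number of edges of
    the small graph.\<close>
  have "2 * 2 \<le> a * b"
    using assms by (intro mult_mono) auto
  moreover have "a * b \<le> s * t"
    using assms by (intro mult_mono) auto
  ultimately have "q \<le> s * t"
    by (simp add: q_def)
  \<comment> \<open>Solving \<open>n \<le> C * r ^ m\<close> for \<open>r\<close> gives the
    constant. The threshold \<open>s + t\<close> leaves room for both parts of a copy.\<close>
  have bound: "C powr (- (1 / real m)) * real n powr (1 / real m) \<le> real (?r n)"
    if "s + t \<le> n" for n
  proof -
    obtain c where c: "c ` edges (complete_bipartite n n) \<subseteq> {..<?r n}"
      "is_coloring (complete_bipartite n n) (complete_bipartite s t) q c"
      using LeastI_ex[OF ex_coloring_complete_bipartite[OF \<open>q \<le> s * t\<close>, of n]]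
      unfolding gen_ramsey_def by blast
    have "0 < n"
      using assms that by simp
    \<comment> \<open>Any edge needs a color, so at least one color is used; positivity is required
      by the size bound and by the passage from powers to \<open>powr\<close>.\<close>
    then have "{Inl 0, Inr 0} \<in> edges (complete_bipartite n n)"
      by (auto simp: complete_bipartite_def)
    then have "0 < ?r n"
      using c(1) by fastforce
    then have "n \<le> (2 * (a + b)) ^ (a + b) * ?r n ^ m"
      unfolding m_def
      using coloring_size_bound[OF _ _ _ _ _ _ _ c(2)[unfolded q_def] c(1)] assms that by simp
    then have "real n \<le> real ((2 * (a + b)) ^ (a + b) * ?r n ^ m)"
      by (rule of_nat_mono)
    then have "real n \<le> C * real (?r n) ^ m"
      by (simp add: C_def)
    then have "real n powr (1 / real m) \<le> (C * real (?r n) ^ m) powr (1 / real m)"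
      by (intro powr_mono2) auto
    also have "\<dots> = C powr (1 / real m) * real (?r n)"
      using \<open>0 < C\<close> \<open>0 < m\<close> \<open>0 < ?r n\<close> by (simp add: powr_mult powr_powr flip: powr_realpow)
    finally show ?thesis
      using \<open>0 < C\<close> by (simp add: powr_minus field_simps)
  qed
  have "(\<lambda>n. real (?r n)) \<in> \<Omega>[at_top](\<lambda>n. real n powr (1 / real m))"
  proof (rule landau_omega.bigI)
    show "C powr (- (1 / real m)) > 0"
      using \<open>0 < C\<close> by simp
    show "eventually (\<lambda>n. norm (real (?r n))
        \<ge> C powr (- (1 / real m)) * norm (real n powr (1 / real m))) at_top"
      using eventually_ge_at_top[of "s + t"] by eventually_elim (use bound in simp)
  qed
  then show ?thesis
    unfolding q_def m_def .
qed

end
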